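(* Let $\mu>3/2$, $-1<\sigma\le0$ and $\beta>0$ be fixed. Then for every $n\in\{0,1,2,\dots\}$ and every $z\in\mathbb{C}$, $$\int_0^{\infty}\xi^{2\mu-1}e^{-\beta\xi^2}\,F^{1:0;0}_{1:0;1}\left(\begin{array}{c}1:-;-;\\ \sigma+1:-;\mu;\end{array}\Big\vert\,z,-\beta z\xi^2\right)L_n^{(\mu-1)}(\beta\xi^2)\,d\xi=\frac{\Gamma(\mu)}{2\beta^{\mu}}\,\frac{z^n}{(\sigma+1)_n}.$$ When $\sigma=0$ it reduces to $$\int_0^{\infty}\xi^{\mu}e^{-\beta\xi^2}J_{\mu-1}\left(2\sqrt{\beta z}\,\xi\right)L_n^{(\mu-1)}(\beta\xi^2)\,d\xi=\frac{z^{n+\frac{\mu-1}{2}}}{n!}\,\frac{e^{-z}}{2\beta^{\frac{\mu+1}{2}}}.$$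
   Context: $(a)_0=1$, $(a)_n=a(a+1)\cdots(a+n-1)$. $L_n^{(\alpha)}$ are the generalized Laguerre polynomials, $J_\nu$ is the Bessel function of the first kind of order $\nu$. The Kampé de Fériet function used here is $$F^{1:0;0}_{1:0;1}\left(\begin{array}{c}1:-;-;\\ \sigma+1:-;\mu;\end{array}\Big\vert\,x,y\right)=\sum_{r,s\ge0}\frac{(1)_{r+s}}{(\sigma+1)_{r+s}\,(\mu)_s}\,\frac{x^r}{r!}\frac{y^s}{s!}.$$ In the second formula, $z^{\frac{\mu-1}{2}}$ and $\sqrt z$ are taken with the same branch of $\log z$. *)

theory Defs
  imports "HOL-Analysis.Analysis"
begin

text \<open>The Kampe de Feriet function \<open>F^{1:0;0}_{1:0;1}(a: -; -; c: -; d; | x, y)\<close>.\<close>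

definition kampe_de_feriet :: "complex \<Rightarrow> complex \<Rightarrow> complex \<Rightarrow> complex \<Rightarrow> complex \<Rightarrow> complex" where
  "kampe_de_feriet a c d x y =
     (\<Sum>\<^sub>\<infinity>(r, s)\<in>UNIV. pochhammer a (r + s) / (pochhammer c (r + s) * pochhammer d s)
                       * (x ^ r / fact r) * (y ^ s / fact s))"

definition laguerre :: "nat \<Rightarrow> real \<Rightarrow> real \<Rightarrow> real" where
  "laguerre n \<alpha> x =
     (\<Sum>k\<le>n. (- 1) ^ k * ((real n + \<alpha>) gchoose (n - k)) * x ^ k / fact k)"

definition bessel_series :: "complex \<Rightarrow> complex \<Rightarrow> complex" where
  "bessel_series \<nu> x =
     (\<Sum>k. (- 1) ^ k * rGamma (\<nu> + of_nat k + 1) / fact k * (x / 2) ^ (2 * k))"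

text \<open>
  Principal branch of the Bessel function of the first kind. The case distinction is needed
  because of the convention \<open>0 powr 0 = 0\<close>.
\<close>

definition bessel_J :: "complex \<Rightarrow> complex \<Rightarrow> complex" where
  "bessel_J \<nu> x = (if \<nu> = 0 then 1 else (x / 2) powr \<nu>) * bessel_series \<nu> x"

text \<open>
  For non-integral \<open>\<nu>\<close>, the Bessel function is multivalued on the punctured plane.
  \<open>bessel_J_log \<nu> l\<close> is its value at \<open>x = exp l\<close> when \<open>l\<close> is the chosen value of \<open>log x\<close>.
\<close>

definition bessel_J_log :: "complex \<Rightarrow> complex \<Rightarrow> complex" where
  "bessel_J_log \<nu> l = exp (\<nu> * (l - of_real (ln 2))) * bessel_series \<nu> (exp l)"

lemma bessel_J_eq_bessel_J_log:
  assumes "x \<noteq> 0"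
  shows "bessel_J \<nu> x = bessel_J_log \<nu> (Ln x)"
proof -
  have "Ln (x / 2) = Ln x - of_real (ln 2)"
    using Ln_divide_of_real[of 2 x] assms by simp
  with assms show ?thesis
    by (simp add: bessel_J_def bessel_J_log_def powr_def)
qed

end

theory Submission
  imports Defs
begin

text \<open>
  Summing the double series along the antidiagonals \<open>r + s = N\<close> writes the Kampe de Feriet function
  at \<open>(z, - z t)\<close> as \<open>\<Sum>N. z ^ N * p\<^sub>N t / pochhammer c N\<close> with the polynomials
  \<open>p\<^sub>N t = (\<Sum>s\<le>N. (N choose s) * (- t) ^ s / pochhammer \<mu> s)\<close>. By the Vandermonde identity, the
  moments \<open>pochhammer \<mu> j\<close> of the weight make \<open>p\<^sub>N\<close> biorthogonal to the Laguerre polynomials, so only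
  the term \<open>N = n\<close> survives termwise integration. For \<open>\<sigma> = 0\<close> the double series factors into
  \<open>exp z\<close> times a Bessel series, so the second integrand is a constant multiple of the first.
\<close>


section \<open>Convergence and antidiagonal rearrangement of the double series\<close>

text \<open>This series is the majorant for both convergence arguments: \<open>k = 0\<close> serves
  the double series, general \<open>k\<close> the interchange of sum and integral. From
  \<open>N\<close> to \<open>N + 1\<close> the numerator symbol grows by a factor of at most
  \<open>1 + k\<close>, while the denominator gains the unbounded factor
  \<open>c + N\<close>.\<close>

lemma summable_power_pochhammer:
  fixes a c R :: real
  assumes "a \<ge> 1" "c > 0" "R \<ge> 0"
  shows "summable (\<lambda>N. R ^ N * pochhammer (a + real N) k / pochhammer c N)"
\<comment> \<open>From this threshold on, \<open>R * (1 + k) / (c + N)\<close> is at most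
  \<open>1 / 2\<close>.\<close>
proof (rule summable_ratio_test[where c = "1 / 2" and N = "nat \<lceil>2 * R * (1 + real k)\<rceil>"])
  fix N assume N: "N \<ge> nat \<lceil>2 * R * (1 + real k)\<rceil>"
  define P where "P = pochhammer (a + real N) k"
  define P' where "P' = pochhammer (a + real (Suc N)) k"
  define Q where "Q = pochhammer c N"
  have pos: "P > 0" "P' > 0" "Q > 0"
    using assms by (auto simp: P_def P'_def Q_def intro!: pochhammer_pos add_pos_nonneg)
  \<comment> \<open>Both sides equal \<open>pochhammer (a + N) (Suc k)\<close>, with the first or
    the last factor split off.\<close>
  have "P' * (a + real N) = P * (a + real N + real k)"
    using pochhammer_rec[of "a + real N" k] pochhammer_Suc[of "a + real N" k]
    by (simp add: P_def P'_def algebra_simps)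
  also have "\<dots> \<le> P * ((1 + real k) * (a + real N))"
  proof (intro mult_left_mono)
    have "real k * 1 \<le> real k * (a + real N)"
      using assms by (intro mult_left_mono) auto
    then show "a + real N + real k \<le> (1 + real k) * (a + real N)"
      by (simp add: algebra_simps)
  qed (use pos in auto)
  finally have P': "P' \<le> P * (1 + real k)"
    using assms by (simp add: mult.assoc[symmetric])
  have "2 * R * (1 + real k) \<le> real N"
    using N by linarith
  then have R: "2 * R * (1 + real k) \<le> c + real N"
    using assms by linarith
  have "2 * (R * P') \<le> 2 * (R * (P * (1 + real k)))"
    using P' assms by (intro mult_left_mono) auto
  also have "\<dots> = P * (2 * R * (1 + real k))"
    by simp
  also have "\<dots> \<le> P * (c + real N)"
    using R pos by (intro mult_left_mono) auto
  finally have "R * P' / (c + real N) \<le> P / 2"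
    using assms by (simp add: field_simps)
  then have "R ^ N / Q * (R * P' / (c + real N)) \<le> R ^ N / Q * (P / 2)"
    using assms pos by (intro mult_left_mono) auto
  moreover have "pochhammer c (Suc N) = Q * (c + real N)"
    by (simp add: Q_def pochhammer_Suc)
  ultimately show "norm (R ^ Suc N * pochhammer (a + real (Suc N)) k / pochhammer c (Suc N))
      \<le> 1 / 2 * norm (R ^ N * pochhammer (a + real N) k / pochhammer c N)"
    unfolding P_def[symmetric] P'_def[symmetric] Q_def[symmetric]
    using assms pos by (simp add: abs_mult mult_ac)
qed simp

lemma pochhammer_ge_1:
  fixes a :: real
  assumes "a \<ge> 1"
  shows "pochhammer a n \<ge> 1"
proof (induction n)
  case (Suc n)
  have "1 * 1 \<le> pochhammer a n * (a + real n)"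
    using Suc assms by (intro mult_mono) auto
  then show ?case by (simp add: pochhammer_Suc)
qed simp

lemma bij_betw_antidiagonals:
  "bij_betw (\<lambda>(N, s). (N - s, s)) (SIGMA N:UNIV. {..N::nat}) UNIV"
  by (rule bij_betw_byWitness[where f' = "\<lambda>(r, s). (r + s, s)"]) auto

text \<open>Since \<open>pochhammer 1 (r + s) = fact (r + s)\<close>, the factorials on the
  antidiagonal \<open>r + s = N\<close> combine to \<open>N choose s\<close>. With
  \<open>pochhammer d s \<ge> 1\<close> the binomial theorem bounds the norms there by
  \<open>(norm x + norm y) ^ N / pochhammer c N\<close>, so the family is absolutely summable and
  may be regrouped.\<close>

lemma
  fixes c d :: real and x y :: complex
  assumes "c > 0" "d \<ge> 1"
  shows kampe_de_feriet_summable_norm: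
      "summable (\<lambda>N. norm ((\<Sum>s\<le>N. of_nat (N choose s) * x ^ (N - s) * y ^ s
          / of_real (pochhammer d s)) / of_real (pochhammer c N)))" (is "summable (\<lambda>N. norm (?P N))")
    and kampe_de_feriet_eq_suminf:
      "kampe_de_feriet 1 (of_real c) (of_real d) x y =
       (\<Sum>N. (\<Sum>s\<le>N. of_nat (N choose s) * x ^ (N - s) * y ^ s
          / of_real (pochhammer d s)) / of_real (pochhammer c N))"
proof -
  define t :: "nat \<Rightarrow> nat \<Rightarrow> complex" where
    "t N s = of_nat (N choose s) * x ^ (N - s) * y ^ s
          / of_real (pochhammer d s) / of_real (pochhammer c N)" for N s
  define T :: "nat \<times> nat \<Rightarrow> complex" where
    "T = (\<lambda>(r, s). pochhammer 1 (r + s)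
          / (pochhammer (of_real c) (r + s) * pochhammer (of_real d) s)
          * (x ^ r / fact r) * (y ^ s / fact s))"
  have P: "?P N = (\<Sum>s\<le>N. t N s)" for N
    by (simp add: t_def sum_divide_distrib)
  have pc: "pochhammer c N > 0" for N
    using assms by (intro pochhammer_pos)
  have pd: "pochhammer d N \<ge> 1" for N
    using assms by (intro pochhammer_ge_1)
  have T: "T (N - s, s) = t N s" if "s \<le> N" for N s
    using that by (simp add: T_def t_def pochhammer_fact[symmetric] pochhammer_of_real binomial_fact)
  have norm_t: "norm (t N s) \<le> real (N choose s) * norm x ^ (N - s) * norm y ^ s / pochhammer c N"
    for N s
  proof -
    have "norm (t N s) = real (N choose s) * norm x ^ (N - s) * norm y ^ s / pochhammer c N
        / pochhammer d s"
      using pc[of N] pd[of s] by (simp add: t_def norm_mult norm_divide norm_power)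
    also have "\<dots> \<le> real (N choose s) * norm x ^ (N - s) * norm y ^ s / pochhammer c N / 1"
      using pc[of N] pd[of s] by (intro divide_left_mono) (auto intro!: divide_nonneg_pos)
    finally show ?thesis by simp
  qed
  have bound: "(\<Sum>s\<le>N. norm (t N s)) \<le> (norm x + norm y) ^ N / pochhammer c N" for N
  proof -
    have "(\<Sum>s\<le>N. norm (t N s)) \<le>
        (\<Sum>s\<le>N. real (N choose s) * norm x ^ (N - s) * norm y ^ s / pochhammer c N)"
      by (intro sum_mono norm_t)
    also have "\<dots> = (norm y + norm x) ^ N / pochhammer c N"
      by (simp add: binomial_ring sum_divide_distrib mult_ac)
    finally show ?thesis by (simp add: add.commute)
  qed
  have summ: "summable (\<lambda>N. (\<Sum>s\<le>N. norm (t N s)))"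
  proof (rule summable_comparison_test'[where N = 0])
    show "summable (\<lambda>N. (norm x + norm y) ^ N / pochhammer c N)"
      using summable_power_pochhammer[of 1 c "norm x + norm y" 0] assms by simp
    show "norm (\<Sum>s\<le>N. norm (t N s)) \<le> (norm x + norm y) ^ N / pochhammer c N" for N
      using bound[of N] by (simp add: sum_nonneg)
  qed
  show "summable (\<lambda>N. norm (?P N))"
    unfolding P by (rule summable_comparison_test'[OF summ, where N = 0]) (simp add: norm_sum)
  then have PU: "(?P has_sum suminf ?P) UNIV"
    by (intro norm_summable_imp_has_sum summable_sums) (auto intro: summable_norm_cancel)
  have "(\<lambda>p. norm (case p of (N, s) \<Rightarrow> t N s)) summable_on (SIGMA N:UNIV. {..N})"
    using summ by (subst Infinite_Sum.abs_summable_on_Sigma_iff)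
      (auto simp: infsum_nonneg sum_nonneg summable_on_UNIV_nonneg_real_iff)
  then have "(\<lambda>(N, s). t N s) summable_on (SIGMA N:UNIV. {..N})"
    by (rule abs_summable_summable)
  then have "(\<Sum>\<^sub>\<infinity>N. \<Sum>\<^sub>\<infinity>s\<in>{..N}. t N s) = (\<Sum>\<^sub>\<infinity>(N, s)\<in>(SIGMA N:UNIV. {..N}). t N s)"
    by (rule infsum_Sigma'_banach)
  also have "\<dots> = (\<Sum>\<^sub>\<infinity>p\<in>(SIGMA N:UNIV. {..N}). T ((\<lambda>(N, s). (N - s, s)) p))"
    by (intro infsum_cong) (auto simp: T)
  also have "\<dots> = infsum T UNIV"
    by (rule infsum_reindex_bij_betw[OF bij_betw_antidiagonals])
  also have "\<dots> = kampe_de_feriet 1 (of_real c) (of_real d) x y"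
    by (simp add: kampe_de_feriet_def T_def)
  finally show "kampe_de_feriet 1 (of_real c) (of_real d) x y = suminf ?P"
    using infsumI[OF PU] by (simp add: P)
qed

section \<open>Combinatorial identities behind the biorthogonality\<close>

text \<open>Up to the factor \<open>pochhammer a s\<close>, the left side is the integral of
  \<open>t ^ s\<close> times the Laguerre polynomial against a weight with moments
  \<open>pochhammer a j\<close>. As \<open>(- 1) ^ k * pochhammer (a + s) k / fact k\<close> is
  \<open>- (a + s) gchoose k\<close>, it is a Vandermonde convolution. The upper entries add up to
  \<open>n - s - 1\<close>, free of \<open>a\<close>, and negating this entry gives the right
  side.\<close>

lemma sum_laguerre_pochhammer:
  fixes a :: real
  shows "(\<Sum>k\<le>n. (- 1) ^ k * ((real n + (a - 1)) gchoose (n - k)) / fact k * pochhammer (a + real s) k)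
    = (- 1) ^ n * real (s choose n)"
proof -
  have "(\<Sum>k\<le>n. (- 1) ^ k * ((real n + (a - 1)) gchoose (n - k)) / fact k * pochhammer (a + real s) k)
    = (\<Sum>k=0..n. (- (a + real s) gchoose k) * ((real n + (a - 1)) gchoose (n - k)))"
    unfolding atLeast0AtMost gbinomial_pochhammer[of "- (a + real s)"] minus_minus
    by (intro sum.cong) auto
  also have "\<dots> = (real n - real s - 1) gchoose n"
    unfolding gbinomial_Vandermonde by (simp add: algebra_simps)
  also have "\<dots> = (- 1) ^ n * (real s gchoose n)"
    by (subst gbinomial_negated_upper) simp
  finally show ?thesis
    by (simp add: binomial_gbinomial)
qed

text \<open>Rewriting \<open>(N choose s) * (s choose n)\<close> as
  \<open>(N choose n) * ((N - n) choose (s - n))\<close> leaves the alternating sum of row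
  \<open>N - n\<close> of Pascal's triangle, which vanishes unless \<open>N = n\<close>.\<close>

lemma sum_alternating_choose_choose:
  "(\<Sum>s\<le>N. (- 1) ^ s * real (N choose s) * real (s choose n)) = (if N = n then (- 1) ^ n else 0)"
proof (cases "n \<le> N")
  case True
  have "(\<Sum>s\<le>N. (- 1) ^ s * real (N choose s) * real (s choose n))
      = (\<Sum>s\<in>{n..N}. (- 1) ^ s * real (N choose s) * real (s choose n))"
    by (rule sum.mono_neutral_right) (auto simp: binomial_eq_0)
  also have "\<dots> = (\<Sum>s\<in>{n..N}. (- 1) ^ s * real (N choose n) * real ((N - n) choose (s - n)))"
    using choose_mult[of n _ N]
    by (intro sum.cong refl) (simp add: mult.assoc flip: of_nat_mult)
  also have "\<dots> = (\<Sum>i\<le>N - n. (- 1) ^ (i + n) * real (N choose n) * real ((N - n) choose i))"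
    using True by (intro sum.reindex_bij_witness[where i = "\<lambda>i. i + n" and j = "\<lambda>s. s - n"]) auto
  also have "\<dots> = (- 1) ^ n * real (N choose n) * (\<Sum>i\<le>N - n. (- 1) ^ i * of_nat ((N - n) choose i))"
    by (simp add: sum_distrib_left power_add mult_ac)
  also have "\<dots> = (if N = n then (- 1) ^ n else 0)"
    using True choose_alternating_sum[of "N - n", where ?'a = real] by (cases "N = n") auto
  finally show ?thesis .
next
  case False
  then show ?thesis by (auto intro!: sum.neutral simp: binomial_eq_0)
qed

section \<open>The Gaussian integral as a Gamma value\<close>

text \<open>The substitution \<open>t = \<beta> * \<xi>\<^sup>2\<close> in Euler's integral for
  \<open>Gamma a\<close> produces the weight times the constant
  \<open>2 * \<beta> powr a\<close>.\<close>

lemma has_bochner_integral_Gamma_gaussian: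
  fixes a \<beta> :: real
  assumes "a > 0" "\<beta> > 0"
  shows "has_bochner_integral lborel
    (\<lambda>\<xi>. indicator {0<..} \<xi> * (\<xi> powr (2 * a - 1) * exp (- \<beta> * \<xi>\<^sup>2)))
    (Gamma a / (2 * \<beta> powr a))"
proof -
  let ?F = "\<lambda>t::real. t powr (a - 1) / exp t"
  let ?W = "\<lambda>\<xi>. \<xi> powr (2 * a - 1) * exp (- \<beta> * \<xi>\<^sup>2)"
  \<comment> \<open>Dropping the endpoint 0 changes nothing in the integral and leaves the domain
    that the substitution maps bijectively onto itself.\<close>
  have I: "(?F has_integral Gamma a) {0<..}"
    using Gamma_integral_real[OF assms(1)]
    by (subst has_integral_spike_set_eq[where T = "{0..}"])
       (auto intro: empty_imp_negligible intro!: negligible_subset[OF negligible_sing[of 0]])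
  have img: "(\<lambda>\<xi>. \<beta> * \<xi>\<^sup>2) ` {0<..} = {0<..}"
  proof safe
    fix t :: real assume "t > 0"
    then show "t \<in> (\<lambda>\<xi>. \<beta> * \<xi>\<^sup>2) ` {0<..}"
      using assms by (intro image_eqI[where x = "sqrt (t / \<beta>)"]) auto
  qed (use assms in auto)
  have inj: "inj_on (\<lambda>\<xi>. \<beta> * \<xi>\<^sup>2) {0<..}"
    using assms by (auto intro!: inj_onI simp: power2_eq_iff_nonneg)
  have F: "?F absolutely_integrable_on {0<..}"
    using I by (intro nonnegative_absolutely_integrable_1) (auto simp: has_integral_integrable)
  have der: "((\<lambda>\<xi>. \<beta> * \<xi>\<^sup>2) has_field_derivative 2 * \<beta> * \<xi>) (at \<xi> within {0<..})" for \<xi>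
    by (auto intro!: derivative_eq_intros)
  have "(\<lambda>\<xi>. \<bar>2 * \<beta> * \<xi>\<bar> * ?F (\<beta> * \<xi>\<^sup>2)) absolutely_integrable_on {0<..} \<and>
      integral {0<..} (\<lambda>\<xi>. \<bar>2 * \<beta> * \<xi>\<bar> * ?F (\<beta> * \<xi>\<^sup>2)) = Gamma a"
    using F I by (subst has_absolute_integral_change_of_variables_1'[OF _ der inj])
      (auto simp: img has_integral_iff)
  then have J: "((\<lambda>\<xi>. \<bar>2 * \<beta> * \<xi>\<bar> * ?F (\<beta> * \<xi>\<^sup>2)) has_integral Gamma a) {0<..}"
    by (auto simp: has_integral_iff set_lebesgue_integral_eq_integral)
  have eq: "\<bar>2 * \<beta> * \<xi>\<bar> * ?F (\<beta> * \<xi>\<^sup>2) = 2 * \<beta> powr a * ?W \<xi>" if "\<xi> > 0" for \<xi>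
  proof -
    have "(\<beta> * \<xi>\<^sup>2) powr (a - 1) = \<beta> powr a / \<beta> * (\<xi> powr (2 * a - 1) / \<xi>)"
      using that assms by (simp add: powr_mult powr_diff powr_powr power2_eq_square
          flip: powr_add)
    then show ?thesis
      using that assms by (simp add: exp_minus field_simps)
  qed
  have "((\<lambda>\<xi>. 2 * \<beta> powr a * ?W \<xi>) has_integral Gamma a) {0<..}"
    using J by (rule has_integral_eq[rotated]) (simp only: eq greaterThan_iff)
  then have "((\<lambda>\<xi>. 1 / (2 * \<beta> powr a) * (2 * \<beta> powr a * ?W \<xi>)) has_integral
      1 / (2 * \<beta> powr a) * Gamma a) {0<..}"
    by (rule has_integral_mult_right)
  then have W: "(?W has_integral Gamma a / (2 * \<beta> powr a)) {0<..}"
    using assms by simp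
  \<comment> \<open>The integrand is nonnegative, so the value of the gauge integral passes to the
    nonnegative Lebesgue integral; its finiteness then gives Bochner integrability.\<close>
  have "integral\<^sup>N lborel (\<lambda>\<xi>. indicator {0<..} \<xi> * ?W \<xi>) = Gamma a / (2 * \<beta> powr a)"
    using nn_integral_has_integral_lebesgue[OF _ W] by simp
  then show ?thesis
    using assms by (intro has_bochner_integral_nn_integral) (auto simp: mult_ac)
qed


section \<open>Termwise integration against a weight with Pochhammer moments\<close>

lemma pochhammer_mono:
  fixes a b :: real
  assumes "0 \<le> a" "a \<le> b"
  shows "pochhammer a n \<le> pochhammer b n"
  unfolding pochhammer_prod using assms by (intro prod_mono) auto

text \<open>Each antidiagonal term times the Laguerre polynomial is a polynomial in
  \<open>t\<close>, so its integral depends on the moments alone; this is why measure, weight and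
  variable stay abstract. All these integrals vanish except the one with \<open>N = n\<close>, and
  the integrals of the norms are summable.\<close>

lemma has_bochner_integral_kampe_de_feriet_laguerre:
  fixes W t :: "'a \<Rightarrow> real" and \<mu> c C :: real and z :: complex
  assumes \<mu>: "\<mu> \<ge> 1" and c: "c > 0"
    and W: "\<And>x. W x \<ge> 0" and t: "\<And>x. t x \<ge> 0"
    and moments: "\<And>j. has_bochner_integral M (\<lambda>x. W x * t x ^ j) (C * pochhammer \<mu> j)"
  shows "has_bochner_integral M
    (\<lambda>x. of_real (W x) * kampe_de_feriet 1 (of_real c) (of_real \<mu>) z (- z * of_real (t x))
      * of_real (laguerre n (\<mu> - 1) (t x)))
    (of_real C * (z ^ n / of_real (pochhammer c n)))"
proof -
  \<comment> \<open>\<open>l\<close> holds the Laguerre coefficients, \<open>q N\<close> those of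
    the polynomial on the antidiagonal \<open>N\<close>. \<open>F N\<close> is the
    \<open>N\<close>-th term of the whole integrand and \<open>G N\<close> its real part after
    splitting off \<open>z ^ N\<close>; \<open>B N\<close> is \<open>G N\<close> with the
    coefficients replaced by their absolute values.\<close>
  define l :: "nat \<Rightarrow> real" where
    "l k = (- 1) ^ k * ((real n + (\<mu> - 1)) gchoose (n - k)) / fact k" for k
  define q :: "nat \<Rightarrow> nat \<Rightarrow> real" where
    "q N s = (- 1) ^ s * real (N choose s) / pochhammer \<mu> s" for N s
  define P where
    "P N x = (\<Sum>s\<le>N. of_nat (N choose s) * z ^ (N - s) * (- z * of_real (t x)) ^ s
          / of_real (pochhammer \<mu> s)) / of_real (pochhammer c N)" for N x
  define G :: "nat \<Rightarrow> 'a \<Rightarrow> real" where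
    "G N x = (\<Sum>s\<le>N. \<Sum>k\<le>n. q N s * l k * (W x * t x ^ (s + k))) / pochhammer c N" for N x
  define B :: "nat \<Rightarrow> 'a \<Rightarrow> real" where
    "B N x = (\<Sum>s\<le>N. \<Sum>k\<le>n. \<bar>q N s\<bar> * \<bar>l k\<bar> * (W x * t x ^ (s + k))) / pochhammer c N" for N x
  define F :: "nat \<Rightarrow> 'a \<Rightarrow> complex" where "F N x = z ^ N * of_real (G N x)" for N x
  have pc: "pochhammer c N > 0" for N
    using c by (intro pochhammer_pos)
  have p\<mu>: "pochhammer \<mu> N > 0" for N
    using \<mu> by (intro pochhammer_pos) auto
  \<comment> \<open>\<open>C\<close> is the moment of order 0, hence nonnegative; the estimate of
    the integral of \<open>B N\<close> relies on this.\<close>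
  have "C = integral\<^sup>L M (\<lambda>x. W x * t x ^ 0)"
    using has_bochner_integral_integral_eq[OF moments[of 0]] by simp
  then have C: "C \<ge> 0"
    using W by simp

  have lag: "laguerre n (\<mu> - 1) y = (\<Sum>k\<le>n. l k * y ^ k)" for y
    by (simp add: laguerre_def l_def)
  have PG: "of_real (W x) * P N x * of_real (laguerre n (\<mu> - 1) (t x)) = F N x" for N x
  proof -
    have "P N x = z ^ N * of_real ((\<Sum>s\<le>N. q N s * t x ^ s) / pochhammer c N)"
    proof -
      have "of_nat (N choose s) * z ^ (N - s) * (- z * of_real (t x)) ^ s / of_real (pochhammer \<mu> s)
          = z ^ N * of_real (q N s * t x ^ s)" if "s \<le> N" for s
      proof -
        have zN: "z ^ N = z ^ (N - s) * z ^ s"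
          using that by (simp flip: power_add)
        have "(- z * of_real (t x)) ^ s = (- 1) ^ s * z ^ s * of_real (t x) ^ s"
          by (simp only: power_mult_distrib power_minus[of z])
        then show ?thesis
          unfolding zN q_def
          by (simp only: of_real_mult of_real_divide of_real_power of_real_minus of_real_1
              of_real_of_nat_eq times_divide_eq_left times_divide_eq_right mult_ac)
      qed
      then show ?thesis
        by (simp add: P_def sum_distrib_left)
    qed
    moreover have "G N x = W x * ((\<Sum>s\<le>N. q N s * t x ^ s) / pochhammer c N)
        * laguerre n (\<mu> - 1) (t x)"
      by (simp add: G_def lag sum_product power_add sum_distrib_left mult_ac)
    ultimately show ?thesis
      by (simp add: F_def)
  qed
  have kdf: "(\<lambda>N. F N x) sums (of_real (W x) * kampe_de_feriet 1 (of_real c) (of_real \<mu>) z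
      (- z * of_real (t x)) * of_real (laguerre n (\<mu> - 1) (t x)))"
    and norm_F: "summable (\<lambda>N. norm (F N x))" for x
  proof -
    have S: "summable (\<lambda>N. norm (P N x))"
      unfolding P_def by (rule kampe_de_feriet_summable_norm[OF c \<mu>])
    then have "(\<lambda>N. P N x) sums (\<Sum>N. P N x)"
      by (rule summable_sums[OF summable_norm_cancel])
    also have "(\<Sum>N. P N x) = kampe_de_feriet 1 (of_real c) (of_real \<mu>) z (- z * of_real (t x))"
      unfolding P_def by (rule kampe_de_feriet_eq_suminf[OF c \<mu>, symmetric])
    finally show "(\<lambda>N. F N x) sums (of_real (W x) * kampe_de_feriet 1 (of_real c) (of_real \<mu>) z
      (- z * of_real (t x)) * of_real (laguerre n (\<mu> - 1) (t x)))"
      unfolding PG[symmetric] by (intro sums_mult sums_mult2)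
    show "summable (\<lambda>N. norm (F N x))"
      unfolding PG[symmetric] norm_mult by (intro summable_mult summable_mult2 S)
  qed

  have "has_bochner_integral M (G N)
      ((\<Sum>s\<le>N. \<Sum>k\<le>n. q N s * l k * (C * pochhammer \<mu> (s + k))) / pochhammer c N)" for N
    unfolding G_def
    by (intro has_bochner_integral_divide_zero has_bochner_integral_sum
        has_bochner_integral_mult_right moments)
  \<comment> \<open>The moment splits as
    \<open>pochhammer \<mu> s * pochhammer (\<mu> + s) k\<close>. The first factor cancels the
    denominator of \<open>q N s\<close>, the second feeds the Vandermonde sum over \<open>k\<close>;
    the signs \<open>(- 1) ^ n\<close> of the two combinatorial identities cancel.\<close>
  moreover have "(\<Sum>s\<le>N. \<Sum>k\<le>n. q N s * l k * (C * pochhammer \<mu> (s + k)))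
      = (if N = n then C else 0)" for N
  proof -
    have "(\<Sum>k\<le>n. q N s * l k * (C * pochhammer \<mu> (s + k)))
        = C * (- 1) ^ n * ((- 1) ^ s * real (N choose s) * real (s choose n))" for s
    proof -
      have "(\<Sum>k\<le>n. q N s * l k * (C * pochhammer \<mu> (s + k)))
          = C * (q N s * pochhammer \<mu> s) * (\<Sum>k\<le>n. l k * pochhammer (\<mu> + real s) k)"
        by (simp add: sum_distrib_left pochhammer_product' mult_ac)
      also have "q N s * pochhammer \<mu> s = (- 1) ^ s * real (N choose s)"
        using p\<mu>[of s] by (simp add: q_def)
      also have "(\<Sum>k\<le>n. l k * pochhammer (\<mu> + real s) k) = (- 1) ^ n * real (s choose n)"
        unfolding l_def by (rule sum_laguerre_pochhammer)
      finally show ?thesis by simp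
    qed
    then show ?thesis
      by (simp add: sum_alternating_choose_choose flip: sum_distrib_left power_add)
  qed
  ultimately have int_G: "has_bochner_integral M (G N) ((if N = n then C else 0) / pochhammer c N)"
    for N by simp
  have int_F: "has_bochner_integral M (F N)
      (z ^ N * of_real ((if N = n then C else 0) / pochhammer c N))" for N
    unfolding F_def by (intro has_bochner_integral_mult_right has_bochner_integral_of_real int_G)

  have int_B: "has_bochner_integral M (B N)
      ((\<Sum>s\<le>N. \<Sum>k\<le>n. \<bar>q N s\<bar> * \<bar>l k\<bar> * (C * pochhammer \<mu> (s + k))) / pochhammer c N)" for N
    unfolding B_def
    by (intro has_bochner_integral_divide_zero has_bochner_integral_sum
        has_bochner_integral_mult_right moments)
  have bound_B: "integral\<^sup>L M (B N) \<le>
      C * (\<Sum>k\<le>n. \<bar>l k\<bar> * (2 ^ N * pochhammer (\<mu> + real N) k / pochhammer c N))" for N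
  proof -
    \<comment> \<open>Enlarging \<open>pochhammer (\<mu> + s) k\<close> to
      \<open>pochhammer (\<mu> + N) k\<close> frees it of \<open>s\<close>, and the remaining
      binomials sum to \<open>2 ^ N\<close>.\<close>
    have "(\<Sum>s\<le>N. \<Sum>k\<le>n. \<bar>q N s\<bar> * \<bar>l k\<bar> * (C * pochhammer \<mu> (s + k)))
        \<le> (\<Sum>s\<le>N. \<Sum>k\<le>n. C * \<bar>l k\<bar> * pochhammer (\<mu> + real N) k * real (N choose s))"
    proof (intro sum_mono)
      fix s k assume s: "s \<in> {..N}"
      have "\<bar>q N s\<bar> * pochhammer \<mu> s = real (N choose s)"
        using p\<mu>[of s] by (simp add: q_def abs_mult)
      then have "\<bar>q N s\<bar> * \<bar>l k\<bar> * (C * pochhammer \<mu> (s + k))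
          = C * \<bar>l k\<bar> * pochhammer (\<mu> + real s) k * real (N choose s)"
        by (simp add: pochhammer_product' mult_ac)
      also have "\<dots> \<le> C * \<bar>l k\<bar> * pochhammer (\<mu> + real N) k * real (N choose s)"
        using C \<mu> s by (intro mult_right_mono mult_left_mono pochhammer_mono) auto
      finally show "\<bar>q N s\<bar> * \<bar>l k\<bar> * (C * pochhammer \<mu> (s + k))
        \<le> C * \<bar>l k\<bar> * pochhammer (\<mu> + real N) k * real (N choose s)" .
    qed
    also have "\<dots> = (\<Sum>k\<le>n. C * \<bar>l k\<bar> * pochhammer (\<mu> + real N) k * (\<Sum>s\<le>N. real (N choose s)))"
      by (subst sum.swap) (simp add: sum_distrib_left)
    also have "(\<Sum>s\<le>N. real (N choose s)) = 2 ^ N"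
      using choose_row_sum[of N] by (simp flip: of_nat_sum)
    finally have "integral\<^sup>L M (B N) \<le>
        (\<Sum>k\<le>n. C * \<bar>l k\<bar> * pochhammer (\<mu> + real N) k * 2 ^ N) / pochhammer c N"
      using pc[of N] by (simp add: has_bochner_integral_integral_eq[OF int_B] divide_right_mono)
    then show ?thesis
      by (simp add: sum_distrib_left sum_divide_distrib mult_ac)
  qed
  \<comment> \<open>This is the condition for exchanging sum and integral. The factors
    \<open>2 ^ N\<close> and \<open>norm z ^ N\<close> merge, so the majorant of
    \<open>summable_power_pochhammer\<close> applies with \<open>R = 2 * norm z\<close>.\<close>
  have summ: "summable (\<lambda>N. integral\<^sup>L M (\<lambda>x. norm (F N x)))"
  proof (rule summable_comparison_test'[where N = 0])
    show "summable (\<lambda>N. C * (\<Sum>k\<le>n. \<bar>l k\<bar> *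
        ((2 * norm z) ^ N * pochhammer (\<mu> + real N) k / pochhammer c N)))"
      using \<mu> c by (intro summable_mult summable_sum summable_power_pochhammer) auto
    fix N :: nat
    have norm_F: "norm (F N x) \<le> norm z ^ N * B N x" for x
    proof -
      have "\<bar>\<Sum>s\<le>N. \<Sum>k\<le>n. q N s * l k * (W x * t x ^ (s + k))\<bar>
          \<le> (\<Sum>s\<le>N. \<Sum>k\<le>n. \<bar>q N s * l k * (W x * t x ^ (s + k))\<bar>)"
        by (intro order_trans[OF sum_abs] sum_mono sum_abs)
      also have "\<dots> = (\<Sum>s\<le>N. \<Sum>k\<le>n. \<bar>q N s\<bar> * \<bar>l k\<bar> * (W x * t x ^ (s + k)))"
        using W[of x] t[of x] by (simp add: abs_mult)
      finally have "\<bar>G N x\<bar> \<le> B N x"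
        using pc[of N] by (simp add: G_def B_def divide_right_mono)
      then show ?thesis
        by (simp add: F_def norm_mult norm_power mult_left_mono)
    qed
    have "norm (integral\<^sup>L M (\<lambda>x. norm (F N x))) = integral\<^sup>L M (\<lambda>x. norm (F N x))"
      by simp
    also have "\<dots> \<le> integral\<^sup>L M (\<lambda>x. norm z ^ N * B N x)"
      using int_F[of N] int_B[of N]
      by (intro integral_mono norm_F integrable_norm integrable_mult_right)
         (auto intro: integrable.intros)
    also have "\<dots> = norm z ^ N * integral\<^sup>L M (B N)"
      by simp
    also have "\<dots> \<le> norm z ^ N *
        (C * (\<Sum>k\<le>n. \<bar>l k\<bar> * (2 ^ N * pochhammer (\<mu> + real N) k / pochhammer c N)))"
      using bound_B[of N] by (intro mult_left_mono) auto
    also have "\<dots> = C * (\<Sum>k\<le>n. \<bar>l k\<bar> *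
        ((2 * norm z) ^ N * pochhammer (\<mu> + real N) k / pochhammer c N))"
      by (simp add: sum_distrib_left power_mult_distrib mult_ac)
    finally show "norm (integral\<^sup>L M (\<lambda>x. norm (F N x))) \<le> C * (\<Sum>k\<le>n. \<bar>l k\<bar> *
        ((2 * norm z) ^ N * pochhammer (\<mu> + real N) k / pochhammer c N))" .
  qed

  have F: "integrable M (F N)" for N
    using int_F by (rule integrable.intros)
  have "has_bochner_integral M (\<lambda>x. \<Sum>N. F N x) (\<Sum>N. integral\<^sup>L M (F N))"
    using integrable_suminf[OF F AE_I2[OF norm_F] summ] integral_suminf[OF F AE_I2[OF norm_F] summ]
    by (simp add: has_bochner_integral_iff)
  also have "(\<lambda>x. \<Sum>N. F N x) = (\<lambda>x. of_real (W x) * kampe_de_feriet 1 (of_real c) (of_real \<mu>) z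
      (- z * of_real (t x)) * of_real (laguerre n (\<mu> - 1) (t x)))"
    using sums_unique[OF kdf] by auto
  also have "(\<Sum>N. integral\<^sup>L M (F N)) = (\<Sum>N\<in>{n}. integral\<^sup>L M (F N))"
    by (rule suminf_finite) (simp_all add: has_bochner_integral_integral_eq[OF int_F])
  also have "\<dots> = of_real C * (z ^ n / of_real (pochhammer c n))"
    by (simp add: has_bochner_integral_integral_eq[OF int_F])
  finally show ?thesis .
qed


section \<open>Moments of the Gaussian weight\<close>

text \<open>The factor \<open>\<xi> ^ (2 * j)\<close> shifts \<open>\<mu>\<close> to
  \<open>\<mu> + j\<close> in the Gaussian integral; the powers of \<open>\<beta>\<close> cancel,
  and \<open>Gamma (\<mu> + j) / Gamma \<mu>\<close> is the Pochhammer symbol.\<close>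

lemma has_bochner_integral_gaussian_moment:
  fixes \<mu> \<beta> :: real
  assumes "\<mu> > 0" "\<beta> > 0"
  shows "has_bochner_integral lborel
    (\<lambda>\<xi>. indicator {0<..} \<xi> * (\<xi> powr (2 * \<mu> - 1) * exp (- \<beta> * \<xi>\<^sup>2)) * (\<beta> * \<xi>\<^sup>2) ^ j)
    (Gamma \<mu> / (2 * \<beta> powr \<mu>) * pochhammer \<mu> j)"
proof -
  have "has_bochner_integral lborel
    (\<lambda>\<xi>. \<beta> ^ j * (indicator {0<..} \<xi> * (\<xi> powr (2 * (\<mu> + real j) - 1) * exp (- \<beta> * \<xi>\<^sup>2))))
    (\<beta> ^ j * (Gamma (\<mu> + real j) / (2 * \<beta> powr (\<mu> + real j))))"
    using assms by (intro has_bochner_integral_mult_right has_bochner_integral_Gamma_gaussian) auto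
  also have "(\<lambda>\<xi>. \<beta> ^ j * (indicator {0<..} \<xi> * (\<xi> powr (2 * (\<mu> + real j) - 1) * exp (- \<beta> * \<xi>\<^sup>2))))
    = (\<lambda>\<xi>. indicator {0<..} \<xi> * (\<xi> powr (2 * \<mu> - 1) * exp (- \<beta> * \<xi>\<^sup>2)) * (\<beta> * \<xi>\<^sup>2) ^ j)"
  proof
    fix \<xi> :: real
    have "\<xi> powr (2 * (\<mu> + real j) - 1) = \<xi> powr (2 * \<mu> - 1) * (\<xi>\<^sup>2) ^ j" if "\<xi> > 0"
    proof -
      have "2 * (\<mu> + real j) - 1 = (2 * \<mu> - 1) + real (2 * j)"
        by simp
      then show ?thesis
        using that by (simp only: powr_add powr_realpow power_mult)
    qed
    then show "\<beta> ^ j * (indicator {0<..} \<xi> * (\<xi> powr (2 * (\<mu> + real j) - 1) * exp (- \<beta> * \<xi>\<^sup>2)))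
      = indicator {0<..} \<xi> * (\<xi> powr (2 * \<mu> - 1) * exp (- \<beta> * \<xi>\<^sup>2)) * (\<beta> * \<xi>\<^sup>2) ^ j"
      by (cases "\<xi> > 0") (simp_all add: power_mult_distrib)
  qed
  also have "\<beta> ^ j * (Gamma (\<mu> + real j) / (2 * \<beta> powr (\<mu> + real j)))
    = Gamma \<mu> / (2 * \<beta> powr \<mu>) * pochhammer \<mu> j"
  proof -
    have "pochhammer \<mu> j = Gamma (\<mu> + real j) / Gamma \<mu>"
      using assms by (intro pochhammer_Gamma) (auto elim!: nonpos_Ints_cases)
    moreover have "Gamma \<mu> \<noteq> 0"
      using Gamma_real_pos[of \<mu>] assms by linarith
    ultimately show ?thesis
      using assms by (simp add: powr_add powr_realpow)
  qed
  finally show ?thesis .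
qed

section \<open>Reduction to Bessel functions for \<sigma> = 0\<close>

lemma summable_norm_power_fact_pochhammer:
  fixes d :: real and y :: complex
  assumes "d \<ge> 1"
  shows "summable (\<lambda>s. norm (y ^ s / (fact s * of_real (pochhammer d s))))"
proof (rule summable_comparison_test'[where N = 0])
  show "summable (\<lambda>s. norm (y ^ s /\<^sub>R fact s))"
    by (rule summable_norm_exp)
  show "norm (norm (y ^ s / (fact s * of_real (pochhammer d s)))) \<le> norm (y ^ s /\<^sub>R fact s)" for s
    using pochhammer_ge_1[OF assms, of s] mult_right_mono[of 1 "pochhammer d s" "norm y ^ s"]
    by (simp add: norm_divide norm_mult norm_power field_simps)
qed

text \<open>With both joint parameters equal to 1 the symbols in \<open>r + s\<close> cancel, so the
  variables separate. The antidiagonal form is then the Cauchy product of the two single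
  series.\<close>

lemma kampe_de_feriet_1_1:
  fixes d :: real and x y :: complex
  assumes "d \<ge> 1"
  shows "kampe_de_feriet 1 1 (of_real d) x y =
    exp x * (\<Sum>s. y ^ s / (fact s * of_real (pochhammer d s)))"
proof -
  let ?a = "\<lambda>s. y ^ s / (fact s * of_real (pochhammer d s))"
  let ?b = "\<lambda>r. x ^ r /\<^sub>R fact r"
  have "(\<Sum>s. ?a s) * (\<Sum>r. ?b r) = (\<Sum>N. \<Sum>s\<le>N. ?a s * ?b (N - s))"
    by (rule Cauchy_product[OF summable_norm_power_fact_pochhammer[OF assms] summable_norm_exp])
  also have "\<dots> = (\<Sum>N. (\<Sum>s\<le>N. of_nat (N choose s) * x ^ (N - s) * y ^ s
          / of_real (pochhammer d s)) / of_real (pochhammer 1 N))"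
    unfolding sum_divide_distrib
    by (intro suminf_cong sum.cong refl)
       (simp add: binomial_fact scaleR_conv_of_real field_simps flip: pochhammer_fact)
  also have "\<dots> = kampe_de_feriet 1 1 (of_real d) x y"
    using kampe_de_feriet_eq_suminf[of 1 d x y] assms by simp
  finally show ?thesis
    by (simp add: exp_def mult.commute)
qed

text \<open>The factor \<open>exp (- z)\<close> removes the contribution of the first variable,
  which leaves \<open>z\<close> free to match the first integral. The rest is
  \<open>Gamma (d + k) = Gamma d * pochhammer d k\<close>.\<close>

lemma bessel_series_eq_kampe_de_feriet:
  fixes d :: real and x z :: complex
  assumes "d \<ge> 1"
  shows "bessel_series (of_real (d - 1)) x =
    exp (- z) / of_real (Gamma d) * kampe_de_feriet 1 1 (of_real d) z (- (x / 2)\<^sup>2)"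
proof -
  have rG: "rGamma (of_real (d - 1) + of_nat k + 1 :: complex)
      = 1 / (of_real (Gamma d) * of_real (pochhammer d k))" for k
  proof -
    have "pochhammer d k > 0"
      using assms by (intro pochhammer_pos) auto
    then have "rGamma (d + real k) = rGamma d / pochhammer d k"
      using pochhammer_rGamma[of d k] by (simp add: field_simps)
    moreover have "(of_real (d - 1) + of_nat k + 1 :: complex) = of_real (d + real k)"
      by simp
    ultimately show ?thesis
      by (simp only: rGamma_complex_of_real) (simp add: rGamma_inverse_Gamma divide_simps)
  qed
  have "bessel_series (of_real (d - 1)) x =
      (\<Sum>k. 1 / of_real (Gamma d) * ((- (x / 2)\<^sup>2) ^ k / (fact k * of_real (pochhammer d k))))"
    unfolding bessel_series_def rG
    by (simp only: power_minus[of "(x / 2)\<^sup>2"] power_mult) (simp add: mult_ac)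
  also have "\<dots> = 1 / of_real (Gamma d) * (exp (- z) * exp z *
      (\<Sum>k. (- (x / 2)\<^sup>2) ^ k / (fact k * of_real (pochhammer d k))))"
  proof (subst suminf_mult)
    show "summable (\<lambda>k. (- (x / 2)\<^sup>2) ^ k / (fact k * complex_of_real (pochhammer d k)))"
      by (rule summable_norm_cancel[OF summable_norm_power_fact_pochhammer[OF assms]])
  qed (simp flip: exp_add)
  finally show ?thesis
    using kampe_de_feriet_1_1[OF assms, of z "- (x / 2)\<^sup>2"] by (simp add: mult_ac)
qed

section \<open>The two integral formulas\<close>

text \<open>The Bessel formula appears in two forms: \<open>g\<close> uses principal branches and
  covers \<open>z = 0\<close>, while \<open>h w\<close> covers every simultaneous choice of branch
  for nonzero \<open>z\<close>.\<close>

theorem corollary4p3p1: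
  fixes \<mu> \<sigma> \<beta> :: real and n :: nat and z :: complex
  assumes "\<mu> > 3 / 2" and "- 1 < \<sigma>" and "\<sigma> \<le> 0" and "\<beta> > 0"
  defines "f \<equiv> (\<lambda>\<xi>::real.
      complex_of_real (\<xi> powr (2 * \<mu> - 1) * exp (- \<beta> * \<xi>\<^sup>2))
      * kampe_de_feriet 1 (of_real (\<sigma> + 1)) (of_real \<mu>) z (- of_real \<beta> * z * (of_real \<xi>)\<^sup>2)
      * of_real (laguerre n (\<mu> - 1) (\<beta> * \<xi>\<^sup>2)))"
  defines "g \<equiv> (\<lambda>\<xi>::real.
      complex_of_real (\<xi> powr \<mu> * exp (- \<beta> * \<xi>\<^sup>2))
      * bessel_J (of_real (\<mu> - 1)) (2 * csqrt (of_real \<beta> * z) * of_real \<xi>)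
      * of_real (laguerre n (\<mu> - 1) (\<beta> * \<xi>\<^sup>2)))"
  \<comment> \<open>\<open>w\<close> is an arbitrary value of \<open>log z\<close>; accordingly \<open>ln (2 * sqrt \<beta> * \<xi>) + w / 2\<close>
      is the value of the logarithm of the argument of the Bessel function\<close>
  defines "h \<equiv> (\<lambda>(w::complex) (\<xi>::real).
      complex_of_real (\<xi> powr \<mu> * exp (- \<beta> * \<xi>\<^sup>2))
      * bessel_J_log (of_real (\<mu> - 1)) (of_real (ln (2 * sqrt \<beta> * \<xi>)) + w / 2)
      * of_real (laguerre n (\<mu> - 1) (\<beta> * \<xi>\<^sup>2)))"
  shows "(set_integrable lborel {0<..} f \<and>
      (LBINT \<xi>:{0<..}. f \<xi>)
        = of_real (Gamma \<mu> / (2 * \<beta> powr \<mu>)) * (z ^ n / of_real (pochhammer (\<sigma> + 1) n)))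
    \<and> (\<sigma> = 0 \<longrightarrow>
      (set_integrable lborel {0<..} g \<and>
       (LBINT \<xi>:{0<..}. g \<xi>)
        = z powr of_real (real n + (\<mu> - 1) / 2) / fact n
          * (exp (- z) / of_real (2 * \<beta> powr ((\<mu> + 1) / 2))))
    \<and> (\<forall>w. exp w = z \<longrightarrow>
       set_integrable lborel {0<..} (h w) \<and>
       (LBINT \<xi>:{0<..}. h w \<xi>)
        = exp (of_real (real n + (\<mu> - 1) / 2) * w) / fact n
          * (exp (- z) / of_real (2 * \<beta> powr ((\<mu> + 1) / 2)))))"
proof -
  let ?W = "\<lambda>\<xi>::real. indicator {0<..} \<xi> * (\<xi> powr (2 * \<mu> - 1) * exp (- \<beta> * \<xi>\<^sup>2))"
  let ?F = "of_real (Gamma \<mu> / (2 * \<beta> powr \<mu>)) * (z ^ n / of_real (pochhammer (\<sigma> + 1) n)) :: complex"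
  let ?R = "exp (- z) / of_real (2 * \<beta> powr ((\<mu> + 1) / 2)) :: complex"
  have "has_bochner_integral lborel
    (\<lambda>\<xi>. of_real (?W \<xi>) * kampe_de_feriet 1 (of_real (\<sigma> + 1)) (of_real \<mu>) z (- z * of_real (\<beta> * \<xi>\<^sup>2))
      * of_real (laguerre n (\<mu> - 1) (\<beta> * \<xi>\<^sup>2))) ?F"
    using assms by (intro has_bochner_integral_kampe_de_feriet_laguerre
        has_bochner_integral_gaussian_moment) auto
  also have "(\<lambda>\<xi>. of_real (?W \<xi>) * kampe_de_feriet 1 (of_real (\<sigma> + 1)) (of_real \<mu>) z
        (- z * of_real (\<beta> * \<xi>\<^sup>2)) * of_real (laguerre n (\<mu> - 1) (\<beta> * \<xi>\<^sup>2)))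
      = (\<lambda>\<xi>. indicator {0<..} \<xi> *\<^sub>R f \<xi>)"
  proof
    fix \<xi> :: real
    have arg: "- z * of_real (\<beta> * \<xi>\<^sup>2) = - of_real \<beta> * z * (of_real \<xi>)\<^sup>2"
      by simp
    show "of_real (?W \<xi>) * kampe_de_feriet 1 (of_real (\<sigma> + 1)) (of_real \<mu>) z
        (- z * of_real (\<beta> * \<xi>\<^sup>2)) * of_real (laguerre n (\<mu> - 1) (\<beta> * \<xi>\<^sup>2))
      = indicator {0<..} \<xi> *\<^sub>R f \<xi>"
      unfolding arg f_def by (simp add: indicator_def)
  qed
  finally have f: "has_bochner_integral lborel (\<lambda>\<xi>. indicator {0<..} \<xi> *\<^sub>R f \<xi>) ?F" .

  have h: "has_bochner_integral lborel (\<lambda>\<xi>. indicator {0<..} \<xi> *\<^sub>R h w \<xi>)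
      (exp (of_real (real n + (\<mu> - 1) / 2) * w) / fact n * ?R)"
    if \<sigma>: "\<sigma> = 0" and w: "exp w = z" for w
  proof -
    \<comment> \<open>\<open>K\<close> is the constant ratio of \<open>h w\<close> to
      \<open>f\<close>. The prefactor of the Bessel function also contributes
      \<open>\<xi> powr (\<mu> - 1)\<close>, which raises \<open>\<xi> powr \<mu>\<close> to the
      power in \<open>f\<close>.\<close>
    define K :: complex where "K = of_real (\<beta> powr ((\<mu> - 1) / 2)) * exp (of_real ((\<mu> - 1) / 2) * w)
      * (exp (- z) / of_real (Gamma \<mu>))"
    have "has_bochner_integral lborel (\<lambda>\<xi>. K * (indicator {0<..} \<xi> *\<^sub>R f \<xi>)) (K * ?F)"
      by (intro has_bochner_integral_mult_right f)
    also have "(\<lambda>\<xi>. K * (indicator {0<..} \<xi> *\<^sub>R f \<xi>)) = (\<lambda>\<xi>. indicator {0<..} \<xi> *\<^sub>R h w \<xi>)"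
    proof
      fix \<xi> :: real
      have "K * f \<xi> = h w \<xi>" if \<xi>: "\<xi> > 0"
      proof -
        define l where "l = of_real (ln (2 * sqrt \<beta> * \<xi>)) + w / 2"
        have "exp l = of_real (2 * sqrt \<beta> * \<xi>) * exp (w / 2)"
          unfolding l_def exp_add exp_of_real using \<xi> assms(4) by simp
        \<comment> \<open>The Bessel series sees only this square, which depends on \<open>w\<close>
          through \<open>exp w = z\<close> alone; the branch enters only through the
          prefactor.\<close>
        then have "(exp l / 2)\<^sup>2 = of_real ((sqrt \<beta>)\<^sup>2) * of_real \<xi> ^ 2 * exp (w / 2) ^ 2"
          by (simp add: power_mult_distrib)
        also have "exp (w / 2) ^ 2 = z"
          by (simp add: w flip: exp_double)
        finally have "- (exp l / 2)\<^sup>2 = - of_real \<beta> * z * (of_real \<xi>)\<^sup>2"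
          using assms(4) by simp
        then have series: "bessel_series (of_real (\<mu> - 1)) (exp l) = exp (- z) / of_real (Gamma \<mu>)
            * kampe_de_feriet 1 1 (of_real \<mu>) z (- of_real \<beta> * z * (of_real \<xi>)\<^sup>2)"
          using bessel_series_eq_kampe_de_feriet[of \<mu> "exp l" z] assms(1) by simp
        have "of_real (\<mu> - 1) * (l - of_real (ln 2))
            = of_real ((\<mu> - 1) / 2 * ln \<beta> + (\<mu> - 1) * ln \<xi>) + of_real ((\<mu> - 1) / 2) * w"
          using \<xi> assms(4) by (simp add: l_def ln_mult ln_sqrt algebra_simps)
        then have pre: "exp (of_real (\<mu> - 1) * (l - of_real (ln 2)))
            = of_real (\<beta> powr ((\<mu> - 1) / 2) * \<xi> powr (\<mu> - 1)) * exp (of_real ((\<mu> - 1) / 2) * w)"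
          using \<xi> assms(4) by (simp only: exp_add exp_of_real powr_def) (simp add: exp_add)
        have "\<xi> powr (2 * \<mu> - 1) = \<xi> powr \<mu> * \<xi> powr (\<mu> - 1)"
          by (simp flip: powr_add)
        then show ?thesis
          unfolding h_def f_def l_def[symmetric] bessel_J_log_def series pre K_def \<sigma>
          by (simp only: of_real_mult add_0 of_real_1 mult_ac)
      qed
      then show "K * (indicator {0<..} \<xi> *\<^sub>R f \<xi>) = indicator {0<..} \<xi> *\<^sub>R h w \<xi>"
        by (cases "\<xi> > 0") simp_all
    qed
    \<comment> \<open>Writing \<open>z ^ n\<close> as \<open>exp (n * w)\<close> lets it merge with
      the branch factor of \<open>K\<close> into one exponential.\<close>
    also have "K * ?F = exp (of_real (real n + (\<mu> - 1) / 2) * w) / fact n * ?R"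
    proof -
      have "\<beta> powr \<mu> = \<beta> powr ((\<mu> - 1) / 2) * \<beta> powr ((\<mu> + 1) / 2)"
        by (simp add: add_divide_distrib diff_divide_distrib flip: powr_add)
      moreover have "Gamma \<mu> > 0"
        using assms(1) by (intro Gamma_real_pos) auto
      moreover have "z ^ n = exp (of_nat n * w)"
        by (simp add: exp_of_nat_mult w)
      moreover have "exp (of_real (real n + (\<mu> - 1) / 2) * w)
          = exp (of_nat n * w) * exp (of_real ((\<mu> - 1) / 2) * w)"
        by (simp add: distrib_right flip: exp_add)
      moreover have "of_real (pochhammer (\<sigma> + 1) n) = (fact n :: complex)"
        unfolding \<sigma> add_0 pochhammer_fact[symmetric] by simp
      ultimately show ?thesis
        unfolding K_def using assms(4) by (simp add: mult_ac)
    qed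
    finally show ?thesis .
  qed

  have g: "has_bochner_integral lborel (\<lambda>\<xi>. indicator {0<..} \<xi> *\<^sub>R g \<xi>)
      (z powr of_real (real n + (\<mu> - 1) / 2) / fact n * ?R)"
    if \<sigma>: "\<sigma> = 0"
  proof (cases "z = 0")
    \<comment> \<open>Both sides are 0: \<open>\<mu> - 1\<close> is nonzero, so
      \<open>bessel_J\<close> has the prefactor \<open>0 powr (\<mu> - 1) = 0\<close>, and the power
      of \<open>z\<close> on the right is 0 as well.\<close>
    case True
    then show ?thesis
      using assms(1) by (simp add: g_def bessel_J_def has_bochner_integral_zero)
  next
    case False
    \<comment> \<open>The principal branch is the choice \<open>w = Ln z\<close>. Positive real
      factors add their real logarithm to \<open>Ln\<close>, and
      \<open>Ln (csqrt z) = Ln z / 2\<close> because halving keeps the imaginary part between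
      \<open>- pi\<close> and \<open>pi\<close>.\<close>
    have "g \<xi> = h (Ln z) \<xi>" if \<xi>: "\<xi> > 0" for \<xi>
    proof -
      let ?c = "2 * sqrt \<beta> * \<xi>"
      have arg: "2 * csqrt (of_real \<beta> * z) * of_real \<xi> = of_real ?c * csqrt z"
      proof -
        have "csqrt (of_real \<beta> * z) = of_real (sqrt \<beta>) * csqrt z"
        proof -
          have "Ln (of_real \<beta> * z) = of_real (ln \<beta>) + Ln z"
            using False assms(4) by (simp add: Ln_times_of_real Ln_of_real)
          then have "csqrt (of_real \<beta> * z) = exp (of_real (ln \<beta> / 2)) * csqrt z"
            using False assms(4)
            by (simp add: csqrt_exp_Ln add_divide_distrib exp_add)
          also have "exp (of_real (ln \<beta> / 2) :: complex) = of_real (sqrt \<beta>)"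
            unfolding exp_of_real using assms(4) by (simp add: exp_ln flip: ln_sqrt)
          finally show ?thesis .
        qed
        then show ?thesis by simp
      qed
      have "Ln (csqrt z) = Ln z / 2"
        using False mpi_less_Im_Ln[OF False] Im_Ln_le_pi[OF False] pi_gt_zero
        unfolding csqrt_exp_Ln[OF False] by (intro Ln_exp) auto
      moreover have c: "?c > 0"
        using \<xi> assms(4) by simp
      ultimately have "Ln (of_real ?c * csqrt z) = of_real (ln ?c) + Ln z / 2"
        using False Ln_times_of_real[OF c, of "csqrt z"] Ln_of_real[OF c] by simp
      moreover have "of_real ?c * csqrt z \<noteq> 0"
        using False \<xi> assms(4) by simp
      ultimately have "bessel_J (of_real (\<mu> - 1)) (2 * csqrt (of_real \<beta> * z) * of_real \<xi>)
          = bessel_J_log (of_real (\<mu> - 1)) (of_real (ln ?c) + Ln z / 2)"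
        unfolding arg by (simp only: bessel_J_eq_bessel_J_log simp_thms)
      then show ?thesis
        by (simp only: g_def h_def)
    qed
    then have "(\<lambda>\<xi>. indicator {0<..} \<xi> *\<^sub>R g \<xi>) = (\<lambda>\<xi>. indicator {0<..} \<xi> *\<^sub>R h (Ln z) \<xi>)"
      by (intro ext) (auto split: split_indicator)
    moreover have "z powr of_real (real n + (\<mu> - 1) / 2) = exp (of_real (real n + (\<mu> - 1) / 2) * Ln z)"
      using False by (simp only: powr_def if_False)
    ultimately show ?thesis
      using h[OF \<sigma> exp_Ln[OF False]] by (simp only:)
  qed

  show ?thesis
    using f g h unfolding set_integrable_def set_lebesgue_integral_def has_bochner_integral_iff
    by blast
qed

end
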